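(* Every graph $G$ satisfies $\operatorname{mag}(G)\le\operatorname{vol}(G)^{\log_2 3}$, where $\log_2 3=1.58\ldots$.
   Context: Graphs are finite, simple and undirected. An injection $f:V(G)\to\mathbb{Z}^+$ is antimagic if $f(v)+f(w)\neq f(x)+f(y)$ for all distinct edges $vw,xy\in E(G)$. With $[k]=\{1,\dots,k\}$, $\operatorname{mag}(G)$ is the minimum $k$ such that $G$ has an antimagic injection $V(G)\to[k]$. Given an injection $\lambda:V(G)\to\{0,1\}^d$, for each edge $vw$ let $\lambda(vw)$ be the open line segment in $\mathbb{R}^d$ with endpoints $\lambda(v),\lambda(w)$. Two distinct edges cross if their open segments intersect. $\lambda$ is a $d$-dimensional hypercube drawing of $G$ if no two distinct edges cross; its volume is $2^d$. $\operatorname{vol}(G)$ is the minimum volume of a hypercube drawing of $G$ (over all integers $d\ge0$). *)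

theory Defs
  imports Complex_Main "Jordan_Normal_Form.Matrix"
begin

definition simple_graph :: "'a set \<Rightarrow> 'a set set \<Rightarrow> bool" where
  "simple_graph V E \<longleftrightarrow> finite V \<and> (\<forall>e\<in>E. e \<subseteq> V \<and> card e = 2)"

definition antimagic :: "'a set \<Rightarrow> 'a set set \<Rightarrow> ('a \<Rightarrow> nat) \<Rightarrow> bool" where
  "antimagic V E f \<longleftrightarrow> inj_on f V \<and> (\<forall>v\<in>V. 0 < f v) \<and>
     (\<forall>v w x y. {v, w} \<in> E \<longrightarrow> {x, y} \<in> E \<longrightarrow> {v, w} \<noteq> {x, y} \<longrightarrow> f v + f w \<noteq> f x + f y)"

definition mag :: "'a set \<Rightarrow> 'a set set \<Rightarrow> nat" where
  "mag V E = (LEAST k. \<exists>f. antimagic V E f \<and> f ` V \<subseteq> {1..k})"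

text \<open>As the dimension \<open>d\<close> is minimised over, it cannot be a type; points of \<open>d\<close>-dimensional
  real space are elements of \<^term>\<open>carrier_vec d :: real vec set\<close>.\<close>

definition cube_vertices :: "nat \<Rightarrow> real vec set" where
  "cube_vertices d = {p \<in> carrier_vec d. \<forall>i<d. p $ i \<in> {0, 1}}"

definition open_seg :: "real vec \<Rightarrow> real vec \<Rightarrow> real vec set" where
  "open_seg p q = {(1 - t) \<cdot>\<^sub>v p + t \<cdot>\<^sub>v q | t. 0 < t \<and> t < 1}"

definition hypercube_drawing :: "'a set \<Rightarrow> 'a set set \<Rightarrow> nat \<Rightarrow> ('a \<Rightarrow> real vec) \<Rightarrow> bool" where
  "hypercube_drawing V E d L \<longleftrightarrow> inj_on L V \<and> L ` V \<subseteq> cube_vertices d \<and>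
     (\<forall>v w x y. {v, w} \<in> E \<longrightarrow> {x, y} \<in> E \<longrightarrow> {v, w} \<noteq> {x, y} \<longrightarrow>
        open_seg (L v) (L w) \<inter> open_seg (L x) (L y) = {})"

definition vol :: "'a set \<Rightarrow> 'a set set \<Rightarrow> nat" where
  "vol V E = (LEAST n. \<exists>d L. n = 2 ^ d \<and> hypercube_drawing V E d L)"

end

theory Submission
  imports Defs
begin

text \<open>
  Read the coordinates of a cube vertex as ternary digits. In a sum of two such numbers every digit
  is at most \<open>2\<close>, so there are no carries: if two edges have the same label sum, then the
  coordinatewise sums of their endpoints agree, hence their midpoints agree and the edges cross.
  Since \<open>3 ^ d = (2 ^ d) powr log 2 3\<close>, the labels stay below the claimed bound. A drawing always
  exists, because the standard basis vectors of \<open>card V\<close>-dimensional space can serve as vertices.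
\<close>

lemma digit_sum_less:
  fixes a :: "nat \<Rightarrow> nat"
  assumes "\<And>i. i < d \<Longrightarrow> a i < b"
  shows "(\<Sum>i<d. a i * b ^ i) < b ^ d"
  using assms
proof (induction d)
  case (Suc d)
  have "(\<Sum>i<Suc d. a i * b ^ i) < b ^ d + a d * b ^ d"
    using Suc by simp
  also have "\<dots> = Suc (a d) * b ^ d"
    by simp
  also have "\<dots> \<le> b * b ^ d"
    using Suc.prems[of d] by (intro mult_right_mono) auto
  finally show ?case
    by simp
qed simp

text \<open>Induction peels off the top digit: reducing modulo \<open>b ^ d\<close> isolates the
  lower digits, and dividing by \<open>b ^ d\<close> isolates digit \<open>d\<close>.\<close>

lemma digit_sum_unique:
  fixes a c :: "nat \<Rightarrow> nat"
  assumes "\<And>i. i < d \<Longrightarrow> a i < b" and "\<And>i. i < d \<Longrightarrow> c i < b"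
    and "(\<Sum>i<d. a i * b ^ i) = (\<Sum>i<d. c i * b ^ i)" and "i < d"
  shows "a i = c i"
  using assms
proof (induction d)
  case (Suc d)
  let ?s = "\<lambda>a. \<Sum>i<d. a i * b ^ i"
  have less: "?s a < b ^ d" "?s c < b ^ d"
    using Suc.prems(1,2) by (simp_all add: digit_sum_less)
  have eq: "?s a + a d * b ^ d = ?s c + c d * b ^ d"
    using Suc.prems(3) by simp
  have "b ^ d > 0"
    using less by linarith
  have "?s a = ?s c"
    using arg_cong[OF eq, of "\<lambda>n. n mod b ^ d"] less by simp
  moreover have "a d = c d"
    using arg_cong[OF eq, of "\<lambda>n. n div b ^ d"] less \<open>b ^ d > 0\<close> by simp
  ultimately show ?case
    using Suc.IH Suc.prems(1,2,4) by (cases "i = d") auto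
qed simp

lemma simple_graph_edgeD:
  assumes "simple_graph V E" "{v, w} \<in> E"
  shows "v \<in> V" "w \<in> V"
  using assms by (auto simp: simple_graph_def)

text \<open>Both weights \<open>1 - t\<close> and \<open>t\<close> are positive in the open segment,
  so neither coordinate vanishes. Any single point of the segment thus reveals both endpoints. For
  \<open>j = k\<close> the segment degenerates to the vertex itself.\<close>

lemma support_open_seg_unit_vec:
  assumes "z \<in> open_seg (unit_vec n j) (unit_vec n k)" and "j < n" "k < n"
  shows "{i. i < n \<and> z $ i \<noteq> 0} = {j, k}"
  using assms by (cases "j = k") (auto simp: open_seg_def unit_vec_def split: if_splits)

lemma ex_hypercube_drawing:
  assumes "simple_graph V E"
  shows "\<exists>L. hypercube_drawing V E (card V) L"
proof -
  have "finite V"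
    using assms by (simp add: simple_graph_def)
  then obtain h where h: "bij_betw h V {0..<card V}"
    using ex_bij_betw_finite_nat by blast
  then have inj: "inj_on h V" and lt: "\<And>v. v \<in> V \<Longrightarrow> h v < card V"
    by (auto simp: bij_betw_def)
  define L :: "'a \<Rightarrow> real vec" where "L v = unit_vec (card V) (h v)" for v
  have "inj_on L V"
  proof (rule inj_onI)
    fix v w assume vw: "v \<in> V" "w \<in> V" "L v = L w"
    \<comment> \<open>Coordinate \<open>h v\<close> of \<open>L v\<close> is 1; finding the same
      entry in the unit vector \<open>L w\<close> forces \<open>h w = h v\<close>.\<close>
    then have "L w $ h v = 1"
      using lt by (metis L_def index_unit_vec(2))
    then show "v = w"
      using vw lt inj by (auto simp: L_def inj_on_eq_iff split: if_splits)
  qed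
  moreover have "L ` V \<subseteq> cube_vertices (card V)"
    by (auto simp: L_def cube_vertices_def unit_vec_def)
  moreover have "open_seg (L v) (L w) \<inter> open_seg (L x) (L y) = {}"
    if e: "{v, w} \<in> E" "{x, y} \<in> E" "{v, w} \<noteq> {x, y}" for v w x y
  proof (rule ccontr)
    assume "open_seg (L v) (L w) \<inter> open_seg (L x) (L y) \<noteq> {}"
    then obtain z where z: "z \<in> open_seg (L v) (L w)" "z \<in> open_seg (L x) (L y)"
      by blast
    have V: "v \<in> V" "w \<in> V" "x \<in> V" "y \<in> V"
      using simple_graph_edgeD[OF assms] e by blast+
    \<comment> \<open>Both sides are the support of the common point \<open>z\<close>.\<close>
    have "{h v, h w} = {h x, h y}"
      using z[unfolded L_def, THEN support_open_seg_unit_vec] V lt by simp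
    then have "h ` {v, w} = h ` {x, y}"
      by simp
    with V inj e(3) show False
      by (subst (asm) inj_on_image_eq_iff[of h V]) auto
  qed
  ultimately show ?thesis
    unfolding hypercube_drawing_def by blast
qed

definition ternary :: "nat \<Rightarrow> real vec \<Rightarrow> nat" where
  "ternary d p = (\<Sum>i<d. (if p $ i = 1 then 1 else 0) * 3 ^ i)"

lemma ternary_less: "ternary d p < 3 ^ d"
  unfolding ternary_def by (rule digit_sum_less) simp

lemma ternary_add_eqD:
  assumes "p \<in> cube_vertices d" "q \<in> cube_vertices d" "r \<in> cube_vertices d" "s \<in> cube_vertices d"
    and "ternary d p + ternary d q = ternary d r + ternary d s"
  shows "p + q = r + s"
proof -
  define g :: "real vec \<Rightarrow> nat \<Rightarrow> nat" where "g p i = (if p $ i = 1 then 1 else 0)" for p i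
  have eq: "(\<Sum>i<d. (g p i + g q i) * 3 ^ i) = (\<Sum>i<d. (g r i + g s i) * 3 ^ i)"
    using assms(5) by (simp add: ternary_def g_def distrib_right sum.distrib)
  \<comment> \<open>On cube vertices a digit, cast to \<open>real\<close>, is the coordinate itself,
    so equal digit sums carry over to vectors.\<close>
  have real_g: "real (g u i) = u $ i" if "u \<in> cube_vertices d" "i < d" for u i
    using that by (auto simp: g_def cube_vertices_def)
  have "p $ i + q $ i = r $ i + s $ i" if "i < d" for i
  proof -
    have "g p i + g q i = g r i + g s i"
      by (rule digit_sum_unique[OF _ _ eq that]) (auto simp: g_def)
    then have "real (g p i) + real (g q i) = real (g r i) + real (g s i)"
      by linarith
    then show ?thesis
      using assms that by (simp add: real_g)
  qed
  then show ?thesis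
    using assms by (intro eq_vecI) (auto simp: cube_vertices_def)
qed

lemma midpoint_in_open_seg:
  assumes "p \<in> carrier_vec d" "q \<in> carrier_vec d"
  shows "(1 / 2) \<cdot>\<^sub>v (p + q) \<in> open_seg p q"
  unfolding open_seg_def mem_Collect_eq
  using assms by (intro exI[of _ "1 / 2"]) (simp add: smult_add_distrib_vec)

text \<open>This is the degenerate case of \<open>ternary_add_eqD\<close> in which each vector is
  added to itself.\<close>

lemma inj_on_ternary: "inj_on (ternary d) (cube_vertices d)"
proof (rule inj_onI)
  fix p q assume pq: "p \<in> cube_vertices d" "q \<in> cube_vertices d" "ternary d p = ternary d q"
  then have "p + p = q + q"
    by (intro ternary_add_eqD) auto
  moreover have "dim_vec p = d" "dim_vec q = d"
    using pq by (auto simp: cube_vertices_def)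
  ultimately show "p = q"
    by (auto simp: vec_eq_iff)
qed

text \<open>\<open>Suc\<close> makes the labels positive; it raises every edge sum by 2 and so
  preserves comparisons between edges.\<close>

lemma antimagic_ternary:
  assumes "simple_graph V E" "hypercube_drawing V E d L"
  shows "antimagic V E (\<lambda>v. Suc (ternary d (L v)))"
  unfolding antimagic_def
proof (intro conjI allI impI)
  have L: "inj_on L V" "\<And>v. v \<in> V \<Longrightarrow> L v \<in> cube_vertices d"
    using assms(2) by (auto simp: hypercube_drawing_def)
  then show "inj_on (\<lambda>v. Suc (ternary d (L v))) V"
    using inj_on_ternary[of d] by (auto simp: inj_on_def)
  fix v w x y assume e: "{v, w} \<in> E" "{x, y} \<in> E" "{v, w} \<noteq> {x, y}"
  then have cube: "L v \<in> cube_vertices d" "L w \<in> cube_vertices d"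
      "L x \<in> cube_vertices d" "L y \<in> cube_vertices d"
    using simple_graph_edgeD[OF assms(1)] L by blast+
  then have carrier: "L v \<in> carrier_vec d" "L w \<in> carrier_vec d"
      "L x \<in> carrier_vec d" "L y \<in> carrier_vec d"
    by (auto simp: cube_vertices_def)
  show "Suc (ternary d (L v)) + Suc (ternary d (L w))
      \<noteq> Suc (ternary d (L x)) + Suc (ternary d (L y))"
  proof
    assume "Suc (ternary d (L v)) + Suc (ternary d (L w))
      = Suc (ternary d (L x)) + Suc (ternary d (L y))"
    with cube have "L v + L w = L x + L y"
      by (intro ternary_add_eqD) auto
    \<comment> \<open>Equal endpoint sums give both segments the same midpoint.\<close>
    with carrier have "open_seg (L v) (L w) \<inter> open_seg (L x) (L y) \<noteq> {}"
      using midpoint_in_open_seg by (metis IntI empty_iff)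
    with e assms(2) show False
      unfolding hypercube_drawing_def by blast
  qed
qed simp

theorem lemma6:
  fixes V :: "'a set" and E :: "'a set set"
  assumes "simple_graph V E"
  shows "real (mag V E) \<le> real (vol V E) powr (log 2 3)"
proof -
  \<comment> \<open>Since some drawing exists, the minimum defining \<open>vol\<close> is
    attained.\<close>
  have "\<exists>d L. vol V E = 2 ^ d \<and> hypercube_drawing V E d L"
    unfolding vol_def by (rule LeastI_ex) (use ex_hypercube_drawing[OF assms] in blast)
  then obtain d L where d: "vol V E = 2 ^ d" and L: "hypercube_drawing V E d L"
    by blast
  \<comment> \<open>The strict bound in \<open>ternary_less\<close> absorbs the shift by
    \<open>Suc\<close>.\<close>
  have "(\<lambda>v. Suc (ternary d (L v))) ` V \<subseteq> {1..3 ^ d}"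
    using ternary_less by (auto simp: Suc_le_eq)
  then have "mag V E \<le> 3 ^ d"
    unfolding mag_def using antimagic_ternary[OF assms L] by (intro Least_le) blast
  then have "real (mag V E) \<le> 3 ^ d"
    by (metis of_nat_le_iff of_nat_numeral of_nat_power)
  also have "\<dots> = (2 powr log 2 3) powr real d"
    by (simp add: powr_realpow)
  \<comment> \<open>The two exponents of 2 are interchanged.\<close>
  also have "\<dots> = real (vol V E) powr log 2 3"
    by (simp only: d of_nat_power of_nat_numeral powr_powr mult.commute flip: powr_realpow)
  finally show ?thesis .
qed

end
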